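(* Let $G$ be a connected weighted graph on the node set $V=\{1,\dots,n\}$ with weighted Laplacian $L$ and Moore–Penrose pseudoinverse $L^+$. Let $\mu\in\mathbb{R}^n$ satisfy $\mathbf 1^T\mu=0$, and let $\omega$ be a random vector in $\mathbb{R}^n$ with mean zero, finite second moments, covariance matrix $\Sigma$, and $\sigma^2:=\mathbf 1^T\Sigma\mathbf 1>0$. Then the (unique) solution of the optimization problem $$\min_{\alpha\in\mathbb{R}^n}\ \mathbb{E}\,\mathcal H(\alpha)\quad\text{subject to}\quad \mathbf 1^T\alpha=1$$ is $$\alpha^*=\frac{\Sigma\mathbf 1}{\sigma^2}.$$
   Context: Weighted graph: simple undirected graph on $V=\{1,\dots,n\}$ with symmetric edge weights $\beta_{i,j}=\beta_{j,i}\ge 0$ ($i\ne j$); a missing edge is the same as an edge of weight $0$, and connectedness refers to the edges of positive weight. The weighted Laplacian is $L_{i,i}=\sum_{j\ne i}\beta_{i,j}$, $L_{i,j}=-\beta_{i,j}$ for $i\neq j$. Its Moore–Penrose pseudoinverse is $L^+=(L+\frac1n\mathbf 1\mathbf 1^T)^{-1}-\frac1n\mathbf 1\mathbf 1^T$. $\mathbf 1$ denotes the all-ones vector in $\mathbb{R}^n$. $\Sigma_{i,j}=\mathbb{E}[\omega_i\omega_j]$; $\sigma^2=\mathbf 1^T\Sigma\mathbf 1$ is the variance of $\sum_i\omega_i$. For $\alpha\in\mathbb{R}^n$ put $C_\alpha:=I-\alpha\mathbf 1^T$, $p(\alpha):=C_\alpha(\mu+\omega)=\mu+C_\alpha\omega$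 (the net load profile), and $\mathcal H(\alpha):=\frac12p(\alpha)^TL^+p(\alpha)$ (total loss). *)

theory Defs
  imports "HOL-Probability.Probability"
begin

text \<open>
  The node set is a finite type \<^typ>\<open>'n\<close>, and \<^term>\<open>1 :: real ^ 'n\<close> is the all-ones vector.
  The diagonal of the weight function \<open>b\<close> carries no meaning: no definition depends on it.
\<close>

definition edge_weights :: "('n::finite \<Rightarrow> 'n \<Rightarrow> real) \<Rightarrow> bool" where
  "edge_weights b \<longleftrightarrow> (\<forall>i j. i \<noteq> j \<longrightarrow> b i j = b j i \<and> 0 \<le> b i j)"

definition edges :: "('n::finite \<Rightarrow> 'n \<Rightarrow> real) \<Rightarrow> ('n \<times> 'n) set" where
  "edges b = {(i, j). i \<noteq> j \<and> 0 < b i j}"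

definition connected_graph :: "('n::finite \<Rightarrow> 'n \<Rightarrow> real) \<Rightarrow> bool" where
  "connected_graph b \<longleftrightarrow> (\<forall>i j. (i, j) \<in> (edges b)\<^sup>*)"

definition laplacian :: "('n::finite \<Rightarrow> 'n \<Rightarrow> real) \<Rightarrow> real ^ 'n ^ 'n" where
  "laplacian b = (\<chi> i j. if i = j then \<Sum>k\<in>UNIV - {i}. b i k else - b i j)"

definition outer :: "real ^ 'n \<Rightarrow> real ^ 'n \<Rightarrow> real ^ 'n ^ ('n::finite)" where
  "outer v w = (\<chi> i j. v $ i * w $ j)"

text \<open>
  This is the Moore-Penrose pseudoinverse only when \<open>L\<close> is the Laplacian of a connected weighted
  graph; the Penrose equations are derived below.
\<close>

definition laplacian_pinv :: "real ^ 'n ^ 'n \<Rightarrow> real ^ 'n ^ ('n::finite)" where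
  "laplacian_pinv L =
     matrix_inv (L + (1 / real CARD('n)) *\<^sub>R outer 1 1) - (1 / real CARD('n)) *\<^sub>R outer 1 1"

text \<open>Without centering: this is the covariance matrix for a random vector with mean zero.\<close>

definition covariance_matrix :: "'a measure \<Rightarrow> ('a \<Rightarrow> real ^ 'n) \<Rightarrow> real ^ 'n ^ ('n::finite)" where
  "covariance_matrix M \<omega> = (\<chi> i j. \<integral>x. \<omega> x $ i * \<omega> x $ j \<partial>M)"

definition net_load :: "real ^ 'n \<Rightarrow> real ^ 'n \<Rightarrow> real ^ 'n \<Rightarrow> real ^ ('n::finite)" where
  "net_load \<mu> w \<alpha> = (mat 1 - outer \<alpha> 1) *v (\<mu> + w)"

definition total_loss ::
  "real ^ 'n ^ 'n \<Rightarrow> real ^ 'n \<Rightarrow> real ^ 'n \<Rightarrow> real ^ ('n::finite) \<Rightarrow> real" where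
  "total_loss L \<mu> w \<alpha> =
     1 / 2 * (net_load \<mu> w \<alpha> \<bullet> (laplacian_pinv L *v net_load \<mu> w \<alpha>))"


lemma laplacian_mult_nth:
  "(laplacian b *v x) $ i = (\<Sum>k\<in>UNIV - {i}. b i k * (x $ i - x $ k))"
proof -
  have "(laplacian b *v x) $ i = (\<Sum>j\<in>UNIV. laplacian b $ i $ j * x $ j)"
    by (simp add: matrix_vector_mult_def)
  also have "\<dots> = laplacian b $ i $ i * x $ i + (\<Sum>j\<in>UNIV - {i}. laplacian b $ i $ j * x $ j)"
    by (rule sum.remove) auto
  also have "(\<Sum>j\<in>UNIV - {i}. laplacian b $ i $ j * x $ j) = (\<Sum>j\<in>UNIV - {i}. - b i j * x $ j)"
    by (rule sum.cong) (auto simp: laplacian_def)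
  also have "laplacian b $ i $ i * x $ i = (\<Sum>k\<in>UNIV - {i}. b i k * x $ i)"
    by (simp add: laplacian_def sum_distrib_right)
  finally show ?thesis
    by (simp add: sum.distrib[symmetric] right_diff_distrib)
qed

lemma laplacian_quadratic_form:
  assumes "edge_weights b"
  shows "x \<bullet> (laplacian b *v x) =
    1 / 2 * (\<Sum>i\<in>UNIV. \<Sum>k\<in>UNIV - {i}. b i k * (x $ i - x $ k)\<^sup>2)"
proof -
  define c where "c i k = (if i = k then 0 else b i k)" for i k
  have sym: "c i k = c k i" for i k
    using assms by (auto simp: c_def edge_weights_def)
  have off: "(\<Sum>k\<in>UNIV - {i}. b i k * f k) = (\<Sum>k\<in>UNIV. c i k * f k)" for i and f :: "'a \<Rightarrow> real"
    by (rule sum.mono_neutral_cong_left) (auto simp: c_def)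
  have q: "x \<bullet> (laplacian b *v x) = (\<Sum>i\<in>UNIV. \<Sum>k\<in>UNIV. c i k * (x $ i * (x $ i - x $ k)))"
    by (simp add: inner_vec_def laplacian_mult_nth off sum_distrib_left mult.left_commute)
  also have "\<dots> = (\<Sum>i\<in>UNIV. \<Sum>k\<in>UNIV. c i k * (x $ k * (x $ k - x $ i)))"
    by (subst sum.swap) (simp add: sym)
  finally have q': "x \<bullet> (laplacian b *v x) =
    (\<Sum>i\<in>UNIV. \<Sum>k\<in>UNIV. c i k * (x $ k * (x $ k - x $ i)))" .
  have "2 * (x \<bullet> (laplacian b *v x)) = (\<Sum>i\<in>UNIV. \<Sum>k\<in>UNIV.
      c i k * (x $ i * (x $ i - x $ k)) + c i k * (x $ k * (x $ k - x $ i)))"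
    using q q' by (simp add: sum.distrib)
  also have "\<dots> = (\<Sum>i\<in>UNIV. \<Sum>k\<in>UNIV. c i k * (x $ i - x $ k)\<^sup>2)"
    by (intro sum.cong refl) (simp add: power2_eq_square algebra_simps)
  finally show ?thesis
    by (simp add: off)
qed

lemma laplacian_quadratic_form_nonneg:
  assumes "edge_weights b"
  shows "0 \<le> x \<bullet> (laplacian b *v x)"
  using assms unfolding laplacian_quadratic_form[OF assms]
  by (auto simp: edge_weights_def intro!: sum_nonneg mult_nonneg_nonneg)

lemma laplacian_quadratic_form_zero:
  assumes b: "edge_weights b" and conn: "connected_graph b" and 0: "x \<bullet> (laplacian b *v x) = 0"
  shows "x $ i = x $ j"
proof -
  have nn: "0 \<le> b i k * (x $ i - x $ k)\<^sup>2" if "k \<in> UNIV - {i}" for i k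
    using that b by (auto simp: edge_weights_def)
  have "(\<Sum>i\<in>UNIV. \<Sum>k\<in>UNIV - {i}. b i k * (x $ i - x $ k)\<^sup>2) = 0"
    using 0 unfolding laplacian_quadratic_form[OF b] by simp
  then have "\<forall>i\<in>UNIV. (\<Sum>k\<in>UNIV - {i}. b i k * (x $ i - x $ k)\<^sup>2) = 0"
    by (subst (asm) sum_nonneg_eq_0_iff) (auto intro!: sum_nonneg nn)
  then have edge0: "b i k * (x $ i - x $ k)\<^sup>2 = 0" if "k \<noteq> i" for i k
    using that nn by (subst (asm) sum_nonneg_eq_0_iff) auto
  have edge: "x $ i = x $ k" if "(i, k) \<in> edges b" for i k
    using edge0[of k i] that by (auto simp: edges_def)
  have "(i, j) \<in> (edges b)\<^sup>*"
    using conn by (simp add: connected_graph_def)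
  then show ?thesis
    by induction (auto dest: edge)
qed

lemma transpose_laplacian:
  assumes "edge_weights b"
  shows "transpose (laplacian b) = laplacian b"
  using assms by (auto simp: transpose_def laplacian_def edge_weights_def vec_eq_iff)

lemma outer_mult: "outer v w *v x = (w \<bullet> x) *\<^sub>R v"
  by (simp add: outer_def matrix_vector_mult_def vec_eq_iff inner_vec_def sum_distrib_left
      mult_ac)

lemma laplacian_mult_one: "laplacian b *v 1 = 0"
  by (simp add: vec_eq_iff laplacian_mult_nth)

lemma inner_one_one: "(1 :: real ^ 'n) \<bullet> 1 = real CARD('n::finite)"
  by (simp add: inner_vec_def)

lemma invertible_laplacian_plus:
  fixes b :: "'n::finite \<Rightarrow> 'n \<Rightarrow> real"
  assumes b: "edge_weights b" and conn: "connected_graph b"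
  shows "invertible (laplacian b + (1 / real CARD('n)) *\<^sub>R outer 1 1)"
proof -
  have "x = 0" if 0: "(laplacian b + (1 / real CARD('n)) *\<^sub>R outer 1 1) *v x = 0" for x
  proof -
    have "x \<bullet> ((laplacian b + (1 / real CARD('n)) *\<^sub>R outer 1 1) *v x) =
        x \<bullet> (laplacian b *v x) + (1 \<bullet> x)\<^sup>2 / real CARD('n)"
      by (simp add: matrix_vector_mult_add_rdistrib outer_mult inner_add_right
          power2_eq_square inner_commute flip: scaleR_matrix_vector_assoc)
    then have "x \<bullet> (laplacian b *v x) + (1 \<bullet> x)\<^sup>2 / real CARD('n) = 0"
      using 0 by simp
    then have q: "x \<bullet> (laplacian b *v x) = 0" and s: "(1 \<bullet> x)\<^sup>2 / real CARD('n) = 0"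
      using laplacian_quadratic_form_nonneg[OF b, of x]
      by (simp_all add: add_nonneg_eq_0_iff)
    obtain c where c: "\<And>i. x $ i = c"
      using laplacian_quadratic_form_zero[OF b conn q] by metis
    have "1 \<bullet> x = real CARD('n) * c"
      by (simp add: inner_vec_def c)
    then show "x = 0"
      using s by (simp add: vec_eq_iff c)
  qed
  then show ?thesis
    unfolding invertible_left_inverse matrix_left_invertible_ker by blast
qed

lemma laplacian_pinv_mult:
  fixes b :: "'n::finite \<Rightarrow> 'n \<Rightarrow> real"
  assumes b: "edge_weights b" and conn: "connected_graph b"
  shows "laplacian b ** laplacian_pinv (laplacian b) = mat 1 - (1 / real CARD('n)) *\<^sub>R outer 1 1"
    and "laplacian_pinv (laplacian b) ** laplacian b = mat 1 - (1 / real CARD('n)) *\<^sub>R outer 1 1"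
    and "laplacian_pinv (laplacian b) *v 1 = 0"
proof -
  define P :: "real ^ 'n ^ 'n" where "P = (1 / real CARD('n)) *\<^sub>R outer 1 1"
  define L where "L = laplacian b"
  define N where "N = matrix_inv (L + P)"
  have N: "(L + P) ** N = mat 1" "N ** (L + P) = mat 1"
    using someI_ex[OF invertible_laplacian_plus[OF b conn, unfolded invertible_def]]
    unfolding N_def L_def P_def matrix_inv_def by auto
  have Px: "P *v x = ((1 \<bullet> x) / real CARD('n)) *\<^sub>R 1" for x
    by (simp add: P_def outer_mult flip: scaleR_matrix_vector_assoc)
  have L1: "L *v 1 = 0"
    by (simp add: L_def laplacian_mult_one)
  have LP1: "(L + P) *v 1 = 1"
    by (simp add: matrix_vector_mult_add_rdistrib L1 Px inner_one_one)
  have N1: "N *v 1 = 1"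
    using arg_cong[OF LP1, of "\<lambda>x. N *v x"] N by (simp add: matrix_vector_mul_assoc)
  have oneL: "1 \<bullet> (L *v x) = 0" for x
  proof -
    have "1 \<bullet> (L *v x) = (transpose L *v 1) \<bullet> x"
      by (simp add: dot_lmul_matrix)
    also have "\<dots> = 0"
      using transpose_laplacian[OF b] L1 by (simp add: L_def del: transpose_matrix_vector)
    finally show ?thesis .
  qed
  have pinv: "laplacian_pinv (laplacian b) = N - P"
    by (simp add: laplacian_pinv_def N_def L_def P_def)
  show "laplacian_pinv (laplacian b) *v 1 = 0"
    by (simp add: pinv matrix_vector_mult_diff_rdistrib N1 Px inner_one_one)
  have LN: "L *v (N *v x) + P *v (N *v x) = x" and NL: "N *v (L *v x) + N *v (P *v x) = x" for x
  proof -
    have "(L + P) *v (N *v x) = x" "N *v ((L + P) *v x) = x"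
      by (simp_all only: matrix_vector_mul_assoc N matrix_vector_mul_lid)
    then show "L *v (N *v x) + P *v (N *v x) = x" "N *v (L *v x) + N *v (P *v x) = x"
      by (simp_all only: matrix_vector_mult_add_rdistrib matrix_vector_right_distrib)
  qed
  have oneN: "1 \<bullet> (N *v x) = 1 \<bullet> x" for x
    using arg_cong[OF LN[of x], of "\<lambda>y. 1 \<bullet> y"]
    by (simp add: inner_add_right oneL Px inner_one_one)
  have "L *v ((N - P) *v x) = (mat 1 - P) *v x" for x
    using LN[of x]
    by (simp add: matrix_vector_mult_diff_rdistrib matrix_vector_mult_diff_distrib
        Px matrix_vector_mult_scaleR L1 oneN algebra_simps)
  then show "laplacian b ** laplacian_pinv (laplacian b) =
      mat 1 - (1 / real CARD('n)) *\<^sub>R outer 1 1"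
    unfolding pinv by (simp add: matrix_eq matrix_vector_mul_assoc flip: L_def P_def)
  have "(N - P) *v (L *v x) = (mat 1 - P) *v x" for x
    using NL[of x]
    by (simp add: matrix_vector_mult_diff_rdistrib Px oneL
        matrix_vector_mult_scaleR N1 algebra_simps)
  then show "laplacian_pinv (laplacian b) ** laplacian b =
      mat 1 - (1 / real CARD('n)) *\<^sub>R outer 1 1"
    unfolding pinv by (simp add: matrix_eq matrix_vector_mul_assoc flip: L_def P_def)
qed

theorem laplacian_pinv_penrose:
  fixes b :: "'n::finite \<Rightarrow> 'n \<Rightarrow> real"
  assumes b: "edge_weights b" and conn: "connected_graph b"
  defines "L \<equiv> laplacian b"
  defines "X \<equiv> laplacian_pinv L"
  shows "L ** X ** L = L"
    and "X ** L ** X = X"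
    and "transpose (L ** X) = L ** X"
    and "transpose (X ** L) = X ** L"
proof -
  let ?P = "(1 / real CARD('n)) *\<^sub>R outer 1 1 :: real ^ 'n ^ 'n"
  have sym: "transpose (mat 1 - ?P) = mat 1 - ?P"
    by (auto simp: transpose_def outer_def mat_def vec_eq_iff)
  note mult = laplacian_pinv_mult[OF b conn, folded L_def X_def]
  show "transpose (L ** X) = L ** X" "transpose (X ** L) = X ** L"
    by (simp_all only: mult sym)
  have "L *v ((mat 1 - ?P) *v x) = L *v x" for x
    by (simp add: L_def matrix_vector_mult_diff_rdistrib matrix_vector_mult_diff_distrib outer_mult
        matrix_vector_mult_scaleR laplacian_mult_one flip: scaleR_matrix_vector_assoc)
  then have "L ** (mat 1 - ?P) = L"
    by (simp add: matrix_eq matrix_vector_mul_assoc)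
  then show "L ** X ** L = L"
    using mult(2) by (simp flip: matrix_mul_assoc)
  have "X *v ((mat 1 - ?P) *v x) = X *v x" for x
    using mult(3)
    by (simp add: matrix_vector_mult_diff_rdistrib matrix_vector_mult_diff_distrib outer_mult
        matrix_vector_mult_scaleR flip: scaleR_matrix_vector_assoc)
  then have "X ** (mat 1 - ?P) = X"
    by (simp add: matrix_eq matrix_vector_mul_assoc)
  then show "X ** L ** X = X"
    using mult(1) by (simp flip: matrix_mul_assoc)
qed


lemma integrable_total_loss:
  fixes \<omega> :: "'a \<Rightarrow> real ^ 'n::finite"
  assumes "prob_space M" and meas: "\<omega> \<in> borel_measurable M"
    and sq: "\<And>i. integrable M (\<lambda>x. (\<omega> x $ i)\<^sup>2)"
  shows "integrable M (\<lambda>x. total_loss L \<mu> (\<omega> x) \<alpha>)"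
proof -
  interpret prob_space M by fact
  have [measurable]: "(\<lambda>x. \<omega> x $ i) \<in> borel_measurable M" for i
    using borel_measurable_inner[OF meas borel_measurable_const[of "axis i 1"]]
    by (simp add: inner_axis)
  have int: "integrable M (\<lambda>x. \<omega> x $ i)" for i
    by (rule square_integrable_imp_integrable[OF _ sq]) simp
  have int2: "integrable M (\<lambda>x. \<omega> x $ i * \<omega> x $ j)" for i j
  proof (rule Bochner_Integration.integrable_bound)
    show "integrable M (\<lambda>x. (\<omega> x $ i)\<^sup>2 + (\<omega> x $ j)\<^sup>2)"
      by (intro Bochner_Integration.integrable_add sq)
    have "\<bar>u * v\<bar> \<le> u\<^sup>2 + v\<^sup>2" for u v :: real
    proof -
      have "0 \<le> (\<bar>u\<bar> - \<bar>v\<bar>)\<^sup>2" "0 \<le> \<bar>u\<bar> * \<bar>v\<bar>" by simp_all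
      then show ?thesis unfolding power2_diff abs_mult power2_abs by linarith
    qed
    then show "AE x in M. norm (\<omega> x $ i * \<omega> x $ j) \<le> norm ((\<omega> x $ i)\<^sup>2 + (\<omega> x $ j)\<^sup>2)"
      by simp
  qed simp
  have hh: "integrable M (\<lambda>x. (\<mu> + \<omega> x) $ k * (\<mu> + \<omega> x) $ l)" for k l
    by (simp add: ring_distribs int int2)
  have "integrable M (\<lambda>x. \<Sum>i\<in>UNIV. \<Sum>j\<in>UNIV. \<Sum>k\<in>UNIV. \<Sum>l\<in>UNIV.
      1 / 2 * laplacian_pinv L $ i $ j * (mat 1 - outer \<alpha> 1) $ i $ l * (mat 1 - outer \<alpha> 1) $ j $ k *
      ((\<mu> + \<omega> x) $ k * (\<mu> + \<omega> x) $ l))"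
    by (intro Bochner_Integration.integrable_sum integrable_mult_right hh)
  then show ?thesis
    unfolding total_loss_def net_load_def inner_vec_def matrix_vector_mult_def
    by (simp add: sum_distrib_left sum_distrib_right mult_ac)
qed

end

theory Submission
  imports Defs
begin

text \<open>
  Put \<open>s = 1 \<bullet> \<omega>\<close>. Since \<open>1 \<bullet> \<mu> = 0\<close>, the net load is \<open>\<mu> + \<omega> - s \<alpha>\<close>.
  Moving from \<open>\<alpha>\<^sub>0 = S1 / \<sigma>\<^sup>2\<close> to \<open>\<alpha>\<^sub>0 + d\<close> with \<open>1 \<bullet> d = 0\<close> changes the expected loss by a
  term linear in \<open>d\<close>, which vanishes because \<open>\<alpha>\<^sub>0\<close> makes the net load uncorrelated with \<open>s\<close>,
  plus \<open>\<sigma>\<^sup>2 / 2\<close> times the quadratic form of \<open>L\<^sup>+\<close> at \<open>d\<close>, which is positive for \<open>d \<noteq> 0\<close>.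
\<close>

text \<open>The product is dominated by the sum of the squares. This makes each entry of the
  covariance matrix a genuine integral instead of the default value 0.\<close>

lemma integrable_mult_of_squares:
  fixes f g :: "'a \<Rightarrow> real"
  assumes [measurable]: "f \<in> borel_measurable M" "g \<in> borel_measurable M"
    and f: "integrable M (\<lambda>x. (f x)\<^sup>2)" and g: "integrable M (\<lambda>x. (g x)\<^sup>2)"
  shows "integrable M (\<lambda>x. f x * g x)"
proof (rule Bochner_Integration.integrable_bound)
  show "integrable M (\<lambda>x. (f x)\<^sup>2 + (g x)\<^sup>2)"
    using f g by simp
  have "\<bar>u * v\<bar> \<le> u\<^sup>2 + v\<^sup>2" for u v :: real
  proof -
    have "0 \<le> (\<bar>u\<bar> - \<bar>v\<bar>)\<^sup>2" "0 \<le> \<bar>u\<bar> * \<bar>v\<bar>" by simp_all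
    then show ?thesis unfolding power2_diff abs_mult power2_abs by linarith
  qed
  then show "AE x in M. norm (f x * g x) \<le> norm ((f x)\<^sup>2 + (g x)\<^sup>2)"
    by simp
qed simp

lemma borel_measurable_vec_component:
  fixes \<omega> :: "'a \<Rightarrow> real ^ 'n::finite"
  assumes "\<omega> \<in> borel_measurable M"
  shows "(\<lambda>x. \<omega> x $ i) \<in> borel_measurable M"
  using borel_measurable_inner[OF assms borel_measurable_const[of "axis i 1"]]
  by (simp add: inner_axis)

text \<open>Bilinear expansion into coordinates reduces this to the entries of the covariance
  matrix. The form \<open>has_bochner_integral\<close> carries integrability together with the
  value, so later sums need no separate integrability proofs.\<close>

lemma has_bochner_integral_inner_mult_inner:
  fixes \<omega> :: "'a \<Rightarrow> real ^ 'n::finite"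
  assumes "\<omega> \<in> borel_measurable M" and "\<And>i. integrable M (\<lambda>x. (\<omega> x $ i)\<^sup>2)"
  shows "has_bochner_integral M (\<lambda>x. (u \<bullet> \<omega> x) * (v \<bullet> \<omega> x)) (u \<bullet> (covariance_matrix M \<omega> *v v))"
proof -
  have "has_bochner_integral M (\<lambda>x. \<omega> x $ i * \<omega> x $ j) (covariance_matrix M \<omega> $ i $ j)" for i j
    using integrable_mult_of_squares[OF borel_measurable_vec_component[OF assms(1), of i]
        borel_measurable_vec_component[OF assms(1), of j] assms(2) assms(2)]
    by (simp add: covariance_matrix_def has_bochner_integral_iff)
  then have "has_bochner_integral M
      (\<lambda>x. \<Sum>i\<in>UNIV. \<Sum>j\<in>UNIV. (u $ i * v $ j) * (\<omega> x $ i * \<omega> x $ j))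
      (\<Sum>i\<in>UNIV. \<Sum>j\<in>UNIV. (u $ i * v $ j) * covariance_matrix M \<omega> $ i $ j)"
    by (intro has_bochner_integral_sum has_bochner_integral_mult_right)
  moreover have "(u \<bullet> \<omega> x) * (v \<bullet> \<omega> x) =
      (\<Sum>i\<in>UNIV. \<Sum>j\<in>UNIV. (u $ i * v $ j) * (\<omega> x $ i * \<omega> x $ j))" for x
    unfolding inner_vec_def inner_real_def sum_product by (intro sum.cong refl) (simp add: mult_ac)
  ultimately show ?thesis
    by (simp add: inner_vec_def matrix_vector_mult_def sum_distrib_left mult_ac)
qed

text \<open>A Bochner integral equal to 0 does not show integrability, since 0 is also its default
  value. Integrability of the vector is what allows the mean to be moved through an inner
  product.\<close>

lemma (in prob_space) integrable_vec_of_squares: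
  fixes \<omega> :: "'a \<Rightarrow> real ^ 'n::finite"
  assumes "\<omega> \<in> borel_measurable M" and "\<And>i. integrable M (\<lambda>x. (\<omega> x $ i)\<^sup>2)"
  shows "integrable M \<omega>"
proof -
  have "integrable M (\<lambda>x. \<omega> x $ i)" for i
    using borel_measurable_vec_component[OF assms(1)] assms(2)
    by (rule square_integrable_imp_integrable)
  then have "integrable M (\<lambda>x. \<Sum>i\<in>UNIV. \<omega> x $ i *\<^sub>R axis i (1::real))"
    by (intro Bochner_Integration.integrable_sum integrable_scaleR_left)
  also have "(\<lambda>x. \<Sum>i\<in>UNIV. \<omega> x $ i *\<^sub>R axis i (1::real)) = \<omega>"
    by (simp add: fun_eq_iff vec_eq_iff axis_def if_distrib cong: if_cong)
  finally show ?thesis .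
qed

text \<open>With \<open>y\<close> the image of \<open>d\<close> under the pseudoinverse,
  \<open>L y = d\<close> because \<open>d\<close> is orthogonal to the all-ones vector. Hence the
  form at \<open>d\<close> equals the Laplacian form at \<open>y\<close>, which vanishes only for
  constant \<open>y\<close>, and then \<open>d = L y = 0\<close>.\<close>

lemma laplacian_pinv_pos_def:
  fixes b :: "'n::finite \<Rightarrow> 'n \<Rightarrow> real"
  assumes b: "edge_weights b" and conn: "connected_graph b" and d: "1 \<bullet> d = 0" "d \<noteq> 0"
  shows "0 < d \<bullet> (laplacian_pinv (laplacian b) *v d)"
proof -
  let ?y = "laplacian_pinv (laplacian b) *v d"
  have Ly: "laplacian b *v ?y = d"
    using d(1) by (simp add: matrix_vector_mul_assoc laplacian_pinv_mult(1)[OF b conn]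
        matrix_vector_mult_diff_rdistrib outer_mult flip: scaleR_matrix_vector_assoc)
  have "?y \<bullet> (laplacian b *v ?y) \<noteq> 0"
  proof
    assume "?y \<bullet> (laplacian b *v ?y) = 0"
    then have "?y $ i = ?y $ k" for i k
      by (rule laplacian_quadratic_form_zero[OF b conn])
    then have "(laplacian b *v ?y) $ i = 0" for i
      unfolding laplacian_mult_nth by (intro sum.neutral) (metis diff_self mult_zero_right)
    then show False
      using d(2) Ly by (simp add: vec_eq_iff)
  qed
  then show ?thesis
    using laplacian_quadratic_form_nonneg[OF b, of ?y] Ly by (simp add: inner_commute)
qed

lemma net_load_eq:
  assumes "1 \<bullet> \<mu> = 0"
  shows "net_load \<mu> w \<alpha> = \<mu> + w - (1 \<bullet> w) *\<^sub>R \<alpha>"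
  using assms
  by (simp add: net_load_def matrix_vector_mult_diff_rdistrib outer_mult inner_add_right)

text \<open>Keeping both cross terms in \<open>c\<close> avoids proving that \<open>L\<^sup>+\<close> is symmetric.\<close>

lemma total_loss_add:
  fixes \<mu> w d :: "real ^ 'n::finite" and L :: "real ^ 'n ^ 'n"
  assumes "1 \<bullet> \<mu> = 0"
  defines "K \<equiv> laplacian_pinv L"
  defines "c \<equiv> K *v d + transpose K *v d"
  shows "total_loss L \<mu> w (\<alpha> + d) = total_loss L \<mu> w \<alpha>
    - (1 / 2) * ((c \<bullet> \<mu>) * (1 \<bullet> w) + (c \<bullet> w) * (1 \<bullet> w) - (c \<bullet> \<alpha>) * ((1 \<bullet> w) * (1 \<bullet> w)))
    + (1 / 2) * (d \<bullet> (K *v d)) * ((1 \<bullet> w) * (1 \<bullet> w))"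
proof -
  define p s where "p = net_load \<mu> w \<alpha>" and "s = 1 \<bullet> w"
  have p: "p = \<mu> + w - s *\<^sub>R \<alpha>" and p': "net_load \<mu> w (\<alpha> + d) = p - s *\<^sub>R d"
    by (simp_all add: p_def s_def net_load_eq[OF assms(1)] algebra_simps)
  have "c \<bullet> p = p \<bullet> (K *v d) + d \<bullet> (K *v p)"
    by (simp add: c_def inner_add_left dot_lmul_matrix inner_commute[of "K *v d"])
  moreover have "(p - s *\<^sub>R d) \<bullet> (K *v (p - s *\<^sub>R d)) =
      p \<bullet> (K *v p) - s * (p \<bullet> (K *v d) + d \<bullet> (K *v p)) + (d \<bullet> (K *v d)) * (s * s)"
    by (simp add: matrix_vector_mult_diff_distrib matrix_vector_mult_scaleR inner_diff_left
        inner_diff_right algebra_simps)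
  ultimately have "total_loss L \<mu> w (\<alpha> + d) =
      total_loss L \<mu> w \<alpha> - (1 / 2) * (s * (c \<bullet> p)) + (1 / 2) * (d \<bullet> (K *v d)) * (s * s)"
    unfolding total_loss_def p' K_def[symmetric] p_def[symmetric] by (simp add: algebra_simps)
  \<comment> \<open>Expanding \<open>c \<bullet> p\<close> isolates the random factors
    \<open>s\<close>, \<open>(c \<bullet> w) * s\<close> and \<open>s * s\<close>, whose
    expectations are first and second moments.\<close>
  then show ?thesis
    by (simp add: p s_def inner_add_right inner_diff_right algebra_simps)
qed

text \<open>In expectation the linear term becomes a multiple of
  \<open>c \<bullet> (S *v 1) - (c \<bullet> \<alpha>) * \<sigma>2\<close>, where
  \<open>\<sigma>2\<close> stands for \<open>1 \<bullet> (S *v 1)\<close>; the contribution of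
  \<open>\<mu>\<close> drops out as the mean is zero. The choice of \<open>\<alpha>\<close> makes
  the rest vanish.\<close>

lemma expected_total_loss_add:
  fixes \<mu> :: "real ^ 'n::finite" and \<omega> :: "'a \<Rightarrow> real ^ 'n"
  assumes "prob_space M" and meas: "\<omega> \<in> borel_measurable M"
    and sq: "\<And>i. integrable M (\<lambda>x. (\<omega> x $ i)\<^sup>2)" and mean: "(\<integral>x. \<omega> x \<partial>M) = 0"
    and \<mu>: "1 \<bullet> \<mu> = 0"
  defines "S \<equiv> covariance_matrix M \<omega>"
  assumes \<sigma>2: "1 \<bullet> (S *v 1) \<noteq> 0"
  defines "\<alpha> \<equiv> (1 / (1 \<bullet> (S *v 1))) *\<^sub>R (S *v 1)"
  shows "(\<integral>x. total_loss L \<mu> (\<omega> x) (\<alpha> + d) \<partial>M) = (\<integral>x. total_loss L \<mu> (\<omega> x) \<alpha> \<partial>M)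
    + (1 / 2) * (d \<bullet> (laplacian_pinv L *v d)) * (1 \<bullet> (S *v 1))"
proof -
  interpret prob_space M by fact
  define c where "c = laplacian_pinv L *v d + transpose (laplacian_pinv L) *v d"
  have m: "has_bochner_integral M (\<lambda>x. 1 \<bullet> \<omega> x) 0"
    using has_bochner_integral_inner_right[of 1 M \<omega> 0] integrable_vec_of_squares[OF meas sq] mean
    by (simp add: has_bochner_integral_iff)
  have q: "has_bochner_integral M (\<lambda>x. (u \<bullet> \<omega> x) * (1 \<bullet> \<omega> x)) (u \<bullet> (S *v 1))" for u
    unfolding S_def by (rule has_bochner_integral_inner_mult_inner[OF meas sq])
  have "has_bochner_integral M (\<lambda>x. total_loss L \<mu> (\<omega> x) \<alpha>)
      (\<integral>x. total_loss L \<mu> (\<omega> x) \<alpha> \<partial>M)"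
    using integrable_total_loss[OF \<open>prob_space M\<close> meas sq] by (simp add: has_bochner_integral_iff)
  then have "has_bochner_integral M (\<lambda>x. total_loss L \<mu> (\<omega> x) (\<alpha> + d))
      ((\<integral>x. total_loss L \<mu> (\<omega> x) \<alpha> \<partial>M)
        - (1 / 2) * ((c \<bullet> \<mu>) * 0 + c \<bullet> (S *v 1) - (c \<bullet> \<alpha>) * (1 \<bullet> (S *v 1)))
        + (1 / 2) * (d \<bullet> (laplacian_pinv L *v d)) * (1 \<bullet> (S *v 1)))"
    unfolding total_loss_add[OF \<mu>] c_def[symmetric]
    by (intro has_bochner_integral_add has_bochner_integral_diff has_bochner_integral_mult_right
        m q)
  \<comment> \<open>This is the stationarity condition, and it determines the form of
    \<open>\<alpha>\<close>.\<close>
  moreover have "(c \<bullet> \<alpha>) * (1 \<bullet> (S *v 1)) = c \<bullet> (S *v 1)"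
    using \<sigma>2 by (simp add: \<alpha>_def)
  ultimately show ?thesis
    by (simp add: has_bochner_integral_iff)
qed

theorem theorem5:
  fixes b :: "'n::finite \<Rightarrow> 'n \<Rightarrow> real"
    and \<mu> :: "real ^ 'n"
    and M :: "'a measure"
    and \<omega> :: "'a \<Rightarrow> real ^ 'n"
    and S :: "real ^ 'n ^ 'n"
    and \<sigma>2 :: real
  assumes "edge_weights b"
    and "connected_graph b"
    and "1 \<bullet> \<mu> = 0"
    and "prob_space M"
    and "\<omega> \<in> borel_measurable M"
    and "\<And>i. integrable M (\<lambda>x. (\<omega> x $ i)\<^sup>2)"
    and "(\<integral>x. \<omega> x \<partial>M) = 0"
    and "S = covariance_matrix M \<omega>"
    and "\<sigma>2 = 1 \<bullet> (S *v 1)"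
    and "\<sigma>2 > 0"
  shows "\<forall>\<alpha>. is_arg_min (\<lambda>\<alpha>. \<integral>x. total_loss (laplacian b) \<mu> (\<omega> x) \<alpha> \<partial>M) (\<lambda>\<alpha>. 1 \<bullet> \<alpha> = 1) \<alpha>
     \<longleftrightarrow> \<alpha> = (1 / \<sigma>2) *\<^sub>R (S *v 1)"
proof -
  define \<alpha>0 where "\<alpha>0 = (1 / \<sigma>2) *\<^sub>R (S *v 1)"
  define F where "F \<alpha> = (\<integral>x. total_loss (laplacian b) \<mu> (\<omega> x) \<alpha> \<partial>M)" for \<alpha>
  have feasible: "1 \<bullet> \<alpha>0 = 1"
    using assms(9,10) by (simp add: \<alpha>0_def)
  have less: "F \<alpha>0 < F \<alpha>" if \<alpha>: "1 \<bullet> \<alpha> = 1" "\<alpha> \<noteq> \<alpha>0" for \<alpha>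
  proof -
    have "F (\<alpha>0 + (\<alpha> - \<alpha>0)) = F \<alpha>0 +
        (1 / 2) * ((\<alpha> - \<alpha>0) \<bullet> (laplacian_pinv (laplacian b) *v (\<alpha> - \<alpha>0))) * \<sigma>2"
      using expected_total_loss_add[OF assms(4-7,3), where L = "laplacian b" and d = "\<alpha> - \<alpha>0"]
        assms(8-10)
      unfolding F_def \<alpha>0_def by simp
    moreover have "0 < (\<alpha> - \<alpha>0) \<bullet> (laplacian_pinv (laplacian b) *v (\<alpha> - \<alpha>0))"
      using \<alpha> feasible
      by (intro laplacian_pinv_pos_def[OF assms(1,2)]) (simp_all add: inner_diff_right)
    ultimately show ?thesis
      using \<open>\<sigma>2 > 0\<close> by simp
  qed
  \<comment> \<open>The strict inequality gives both directions: no feasible point beats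
    \<open>\<alpha>0\<close>, and \<open>\<alpha>0\<close> beats every other feasible point.\<close>
  have "is_arg_min F (\<lambda>\<alpha>. 1 \<bullet> \<alpha> = 1) \<alpha> \<longleftrightarrow> \<alpha> = \<alpha>0" for \<alpha>
    using feasible less unfolding is_arg_min_def by (metis less_asym)
  then show ?thesis
    unfolding F_def \<alpha>0_def by blast
qed

end
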